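(* Let $G$ be a graph and let $\ell\ge 2$ be an even integer. Then for every $s\in\{\Delta(G),\Delta(G)+1,\dots,\chi'(G)\}$ there exists a $\mathbb{Z}_\ell$-voltage assignment $\alpha$ on $G$ such that $\chi'(\widetilde G(\alpha,\ell))=s$. Moreover, if $s\neq\chi'(G)$, then $\alpha$ may be chosen so that, in addition, $\chi'(\widetilde G(\alpha',\ell))>\chi'(\widetilde G(\alpha,\ell))$ for every $\mathbb{Z}_\ell$-voltage assignment $\alpha'$ on $G$ with $\operatorname{supp}(\alpha')\subsetneq\operatorname{supp}(\alpha)$.
   Context: All graphs are finite and loopless, but may have parallel edges. $\Delta(G)$ is the maximum degree of $G$, and $\chi'(G)$ is the chromatic index, i.e. the least $k$ such that the edges of $G$ can be colored with $k$ colors so that any two distinct edges sharing an endpoint (in particular, parallel edges) receive distinct colors. Fix an arbitrary reference orientation of $G$; each edge $e$ has a tail $t(e)$ and a head $h(e)$. For an integer $\ell\ge1$, $\mathbb{Z}_\ell$ is the additive cyclic group of residues modulo $\ell$. A $\mathbb{Z}_\ell$-voltage assignment on $G$ is a function $\alpha:E(G)\to\mathbb{Z}_\ell$; its support is $\operatorname{supp}(\alpha)=\{e\in E(G):\alpha(e)\ne0\}$. The $\ell$-fold cyclic cover $\widetilde G(\alpha,\ell)$ of $G$ derived from $\alpha$ is the graph with vertex set $V(G)\times\mathbb{Z}_\ell$ and edge set $E(G)\times\mathbb{Z}_\ell$, where the edge $(e,i)$ joins $(t(e),i)$ and $(h(e),i+\alpha(e))$. *)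

theory Defs
  imports "Graph_Theory.Digraph" "HOL-Algebra.Elementary_Groups"
begin

text \<open>
  A finite loopless multigraph together with a reference orientation is a
  \<^typ>\<open>('a, 'b) pre_digraph\<close> that is a \<^const>\<open>fin_digraph\<close> and a
  \<^const>\<open>loopfree_digraph\<close>: an arc is an edge with its chosen tail and head, and
  parallel edges are distinct arcs. The degree, colouring and chromatic index below
  do not depend on the direction of the arcs.
\<close>

definition degree :: "('a, 'b) pre_digraph \<Rightarrow> 'a \<Rightarrow> nat" where
  "degree G v = in_degree G v + out_degree G v"

text \<open>The inserted 0 only matters for the graph without vertices.\<close>

definition max_degree :: "('a, 'b) pre_digraph \<Rightarrow> nat" where
  "max_degree G = Max (insert 0 (degree G ` verts G))"

definition edge_ends :: "('a, 'b) pre_digraph \<Rightarrow> 'b \<Rightarrow> 'a set" where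
  "edge_ends G e = {tail G e, head G e}"

definition proper_edge_colouring :: "('a, 'b) pre_digraph \<Rightarrow> nat \<Rightarrow> ('b \<Rightarrow> nat) \<Rightarrow> bool" where
  "proper_edge_colouring G k c \<longleftrightarrow>
     c \<in> arcs G \<rightarrow> {..<k} \<and>
     (\<forall>e \<in> arcs G. \<forall>f \<in> arcs G. e \<noteq> f \<and> edge_ends G e \<inter> edge_ends G f \<noteq> {} \<longrightarrow> c e \<noteq> c f)"

definition chromatic_index :: "('a, 'b) pre_digraph \<Rightarrow> nat" where
  "chromatic_index G = (LEAST k. \<exists>c. proper_edge_colouring G k c)"

text \<open>
  Residues modulo \<open>l\<close> are the elements of \<^term>\<open>carrier (integer_mod_group l)\<close>, written multiplicatively with neutral element 0; for
  \<open>l > 0\<close> the carrier is \<open>{0..<int l}\<close>. Values of a voltage assignment outside \<open>arcs G\<close> are irrelevant.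
\<close>

definition voltage_assignment :: "('a, 'b) pre_digraph \<Rightarrow> nat \<Rightarrow> ('b \<Rightarrow> int) \<Rightarrow> bool" where
  "voltage_assignment G l \<alpha> \<longleftrightarrow> \<alpha> \<in> arcs G \<rightarrow> carrier (integer_mod_group l)"

definition voltage_supp :: "('a, 'b) pre_digraph \<Rightarrow> nat \<Rightarrow> ('b \<Rightarrow> int) \<Rightarrow> 'b set" where
  "voltage_supp G l \<alpha> = {e \<in> arcs G. \<alpha> e \<noteq> \<one>\<^bsub>integer_mod_group l\<^esub>}"

definition cyclic_cover ::
  "('a, 'b) pre_digraph \<Rightarrow> nat \<Rightarrow> ('b \<Rightarrow> int) \<Rightarrow> ('a \<times> int, 'b \<times> int) pre_digraph" where
  "cyclic_cover G l \<alpha> =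
     \<lparr> verts = verts G \<times> carrier (integer_mod_group l),
       arcs = arcs G \<times> carrier (integer_mod_group l),
       tail = (\<lambda>(e, i). (tail G e, i)),
       head = (\<lambda>(e, i). (head G e, i \<otimes>\<^bsub>integer_mod_group l\<^esub> \<alpha> e)) \<rparr>"

end

theory Submission
  imports Defs
begin

text \<open>
  Two properties of the chromatic index of the cover, as a function of the voltage assignment,
  carry the proof.

  First, it attains \<open>chromatic_index G\<close> and a value of at most \<open>max_degree G\<close>. The zero
  assignment gives disjoint copies of \<open>G\<close>. Since \<open>l\<close> is even, the constant assignment \<open>l div 2\<close> is
  available; every edge of its cover joins the lower half \<open>{..<l div 2}\<close> of the residues to
  the upper half, so this cover is bipartite and, by Koenig's theorem, edge-colourable with as many
  colours as its maximum degree, which is that of \<open>G\<close>.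

  Secondly, it does not jump: altering the voltage of one arc \<open>e\<close> only rearranges the fibre
  of \<open>e\<close>, which is a matching because \<open>G\<close> is loopless. One fresh colour for this
  fibre turns a colouring of one cover into a colouring of the other.

  Now let \<open>s\<close> lie between the maximum degree and the chromatic index, the latter excluded.
  Among the assignments whose cover has chromatic index at most \<open>s\<close>, take one with smallest
  support. By the choice every assignment with smaller support gives more than \<open>s\<close>. The
  support is nonempty, as the zero assignment exceeds \<open>s\<close>; resetting one of its arcs to zero
  therefore exceeds \<open>s\<close> too, and since this raises the chromatic index by at most one, the
  value was exactly \<open>s\<close>.
\<close>

section \<open>Koenig's edge-colouring theorem\<close>

text \<open>
  The edges of a bipartite multigraph have a left end \<open>a e\<close> and a right end \<open>b e\<close>, so
  a colouring is proper iff the pairs (left end, colour) and (right end, colour) each determine the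
  edge. Induction on the edges: some colour \<open>p\<close> is missing at the left end \<open>x\<close> of the new
  edge and some \<open>q\<close> at its right end \<open>y\<close>. If they differ, swap \<open>p\<close> and \<open>q\<close>
  along the Kempe chain from \<open>x\<close>, after which \<open>q\<close> is missing at \<open>x\<close>. The chain
  enters right vertices only along edges of colour \<open>q\<close>, so it avoids \<open>y\<close>, and \<open>q\<close>
  remains missing there.
\<close>

lemma bipartite_edge_colouring:
  fixes a :: "'e \<Rightarrow> 'x" and b :: "'e \<Rightarrow> 'y"
  assumes "finite E"
    and "\<And>x. card {e \<in> E. a e = x} \<le> k" and "\<And>y. card {e \<in> E. b e = y} \<le> k"
  shows "\<exists>c. c \<in> E \<rightarrow> {..<k} \<and> inj_on (\<lambda>e. (a e, c e)) E \<and> inj_on (\<lambda>e. (b e, c e)) E"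
  using assms
proof (induction E rule: finite_induct)
  case empty
  show ?case by simp
next
  case (insert e0 E)
  have le: "card {e \<in> E. g e = z} \<le> k" if "card {e \<in> insert e0 E. g e = z} \<le> k"
    for g :: "'e \<Rightarrow> 'z" and z
    by (rule order_trans[OF card_mono that]) (use insert.hyps in auto)
  obtain c where c: "c \<in> E \<rightarrow> {..<k}"
      and ca: "inj_on (\<lambda>e. (a e, c e)) E" and cb: "inj_on (\<lambda>e. (b e, c e)) E"
    using insert.IH[OF le le] insert.prems by blast
  have missing: "\<exists>p<k. \<forall>e\<in>E. g e = g e0 \<longrightarrow> c e \<noteq> p"
    if "card {e \<in> insert e0 E. g e = g e0} \<le> k" for g :: "'e \<Rightarrow> 'z"
  proof -
    let ?F = "{e \<in> E. g e = g e0}"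
    have "{e \<in> insert e0 E. g e = g e0} = insert e0 ?F" by auto
    then have "card ?F < k" using that insert.hyps by simp
    then have "card (c ` ?F) < card {..<k}"
      using card_image_le[of ?F c] insert.hyps by simp
    then have "\<not> {..<k} \<subseteq> c ` ?F"
      using card_mono[of "c ` ?F" "{..<k}"] insert.hyps by auto
    then show ?thesis by auto
  qed
  obtain p where p: "p < k" and px: "\<And>e. e \<in> E \<Longrightarrow> a e = a e0 \<Longrightarrow> c e \<noteq> p"
    using missing[OF insert.prems(1)] by blast
  obtain q where q: "q < k" and qy: "\<And>e. e \<in> E \<Longrightarrow> b e = b e0 \<Longrightarrow> c e \<noteq> q"
    using missing[OF insert.prems(2)] by blast
  have a_eq: "e = f" if "e \<in> E" "f \<in> E" "a e = a f" "c e = c f" for e f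
    using ca that by (auto simp: inj_on_def)
  have b_eq: "e = f" if "e \<in> E" "f \<in> E" "b e = b f" "c e = c f" for e f
    using cb that by (auto simp: inj_on_def)
  \<comment> \<open>The left vertices of the Kempe chain from \<open>x\<close>, reached by steps along an edge of
      colour \<open>q\<close> followed by one of colour \<open>p\<close>.\<close>
  define r where "r = {(a e, a f) | e f. e \<in> E \<and> f \<in> E \<and> c e = q \<and> c f = p \<and> b e = b f}"
  define L where "L = r\<^sup>* `` {a e0}"
  have x_L: "a e0 \<in> L" by (simp add: L_def)
  have pred: "\<exists>e\<in>E. c e = q \<and> b e = b f \<and> a e \<in> L"
    if f: "f \<in> E" "c f = p" "a f \<in> L" for f
  proof -
    have "(a e0, a f) \<in> r\<^sup>*" using f by (simp add: L_def)
    then show ?thesis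
    proof (cases rule: rtranclE)
      case base
      then show ?thesis using px f by metis
    next
      case (step u)
      then obtain e f' where "e \<in> E" "f' \<in> E" "c e = q" "c f' = p" "b e = b f'"
          "u = a e" "a f = a f'"
        by (auto simp: r_def)
      then show ?thesis using a_eq[of f f'] f step(1) by (auto simp: L_def)
    qed
  qed
  \<comment> \<open>Selecting the edges to recolour by their left ends is consistent at right vertices too:
      the two edges of colours \<open>p\<close> and \<open>q\<close> there are both recoloured or both kept.\<close>
  have chain: "a e \<in> L \<longleftrightarrow> a f \<in> L"
    if ef: "e \<in> E" "f \<in> E" "c e = q" "c f = p" "b e = b f" for e f
  proof
    assume "a e \<in> L"
    moreover have "(a e, a f) \<in> r" using ef by (auto simp: r_def)
    ultimately show "a f \<in> L" by (auto simp: L_def intro: rtrancl_into_rtrancl)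
  next
    assume "a f \<in> L"
    then obtain e' where "e' \<in> E" "c e' = q" "b e' = b f" "a e' \<in> L" using pred ef by blast
    then show "a e \<in> L" using b_eq[of e e'] ef by auto
  qed
  define c' where "c' e = (if e = e0 then q else if a e \<in> L \<and> c e = p then q
      else if a e \<in> L \<and> c e = q then p else c e)" for e
  have range: "c' \<in> insert e0 E \<rightarrow> {..<k}" using c p q by (auto simp: c'_def)
  have new_a: "c' e \<noteq> q" if "e \<in> E" "a e = a e0" for e
    using px[OF that] that x_L \<open>e0 \<notin> E\<close> by (auto simp: c'_def)
  have new_b: "c' e \<noteq> q" if "e \<in> E" "b e = b e0" for e
    using qy pred[of e] that \<open>e0 \<notin> E\<close> by (auto simp: c'_def)
  have inj_a: "e = f" if "e \<in> E" "f \<in> E" "a e = a f" "c' e = c' f" for e f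
    using that a_eq[of e f] \<open>e0 \<notin> E\<close> by (auto simp: c'_def split: if_splits)
  have inj_b: "e = f" if "e \<in> E" "f \<in> E" "b e = b f" "c' e = c' f" for e f
  proof -
    have "e \<noteq> e0" "f \<noteq> e0" using that \<open>e0 \<notin> E\<close> by auto
    moreover have "a e \<in> L \<longleftrightarrow> a f \<in> L" if "c e \<in> {p, q}" "c f \<in> {p, q}"
    proof (cases "c e = c f")
      case True
      then show ?thesis using b_eq[of e f] \<open>e \<in> E\<close> \<open>f \<in> E\<close> \<open>b e = b f\<close> by simp
    next
      case False
      then have "c e = q \<and> c f = p \<or> c f = q \<and> c e = p" using that by auto
      then show ?thesis
        using chain[of e f] chain[of f e] \<open>e \<in> E\<close> \<open>f \<in> E\<close> \<open>b e = b f\<close> by metis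
    qed
    ultimately have "c e = c f"
      using \<open>c' e = c' f\<close> by (simp add: c'_def split: if_splits)
    then show ?thesis using that b_eq by simp
  qed
  have c'_e0: "c' e0 = q" by (simp add: c'_def)
  have "inj_on (\<lambda>e. (a e, c' e)) (insert e0 E)"
    unfolding inj_on_def prod.inject by (metis c'_e0 new_a inj_a insertE)
  moreover have "inj_on (\<lambda>e. (b e, c' e)) (insert e0 E)"
    unfolding inj_on_def prod.inject by (metis c'_e0 new_b inj_b insertE)
  ultimately show ?case using range by blast
qed

section \<open>The chromatic index\<close>

lemma chromatic_index_le:
  "proper_edge_colouring G k c \<Longrightarrow> chromatic_index G \<le> k"
  unfolding chromatic_index_def by (blast intro: Least_le)

lemma ex_colouring_chromatic_index:
  fixes G :: "('a, 'b) pre_digraph"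
  assumes "finite (arcs G)"
  obtains c where "proper_edge_colouring G (chromatic_index G) c"
proof -
  obtain c :: "'b \<Rightarrow> nat" and n where "c ` arcs G = {i. i < n}" "inj_on c (arcs G)"
    using finite_imp_inj_to_nat_seg[OF assms] by auto
  then have "proper_edge_colouring G n c"
    by (auto simp: proper_edge_colouring_def inj_on_def)
  then have "\<exists>k c. proper_edge_colouring G k c" by blast
  then have "\<exists>c. proper_edge_colouring G (chromatic_index G) c"
    unfolding chromatic_index_def by (rule LeastI_ex)
  then show thesis using that by blast
qed

lemma card_incident_arcs_le:
  assumes "finite (arcs G)"
  shows "card {e \<in> arcs G. v \<in> edge_ends G e} \<le> degree G v"
proof -
  have "{e \<in> arcs G. v \<in> edge_ends G e} = in_arcs G v \<union> out_arcs G v"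
    by (auto simp: edge_ends_def)
  then show ?thesis
    by (simp add: degree_def in_degree_def out_degree_def card_Un_le)
qed

lemma chromatic_index_bipartite_le:
  assumes fin: "finite (arcs G)"
    and deg: "\<And>v. degree G v \<le> k"
    and bip: "\<And>e. e \<in> arcs G \<Longrightarrow> tail G e \<in> X \<longleftrightarrow> head G e \<notin> X"
  shows "chromatic_index G \<le> k"
proof -
  define a where "a e = (if tail G e \<in> X then tail G e else head G e)" for e
  define b where "b e = (if tail G e \<in> X then head G e else tail G e)" for e
  have ends: "edge_ends G e = {a e, b e}" for e
    by (auto simp: edge_ends_def a_def b_def)
  have sides: "a e \<in> X" "b e \<notin> X" if "e \<in> arcs G" for e
    using bip[OF that] by (auto simp: a_def b_def)
  have incident: "card {e \<in> arcs G. g e = v} \<le> k" if "\<And>e. g e \<in> edge_ends G e" for g v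
  proof -
    have "card {e \<in> arcs G. g e = v} \<le> card {e \<in> arcs G. v \<in> edge_ends G e}"
      using fin that by (intro card_mono) auto
    then show ?thesis
      using card_incident_arcs_le[OF fin, of v] deg[of v] by linarith
  qed
  obtain c where "c \<in> arcs G \<rightarrow> {..<k}"
      "inj_on (\<lambda>e. (a e, c e)) (arcs G)" "inj_on (\<lambda>e. (b e, c e)) (arcs G)"
    using bipartite_edge_colouring[OF fin incident[of a] incident[of b]] ends by auto
  moreover have "a e = a f \<or> b e = b f"
    if "e \<in> arcs G" "f \<in> arcs G" "edge_ends G e \<inter> edge_ends G f \<noteq> {}" for e f
    using that sides[of e] sides[of f] by (auto simp: ends)
  ultimately have "proper_edge_colouring G k c"
    unfolding proper_edge_colouring_def inj_on_def by blast
  then show ?thesis by (rule chromatic_index_le)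
qed

section \<open>Cyclic covers\<close>

lemma cyclic_cover_simps [simp]:
  "verts (cyclic_cover G l \<alpha>) = verts G \<times> carrier (integer_mod_group l)"
  "arcs (cyclic_cover G l \<alpha>) = arcs G \<times> carrier (integer_mod_group l)"
  "tail (cyclic_cover G l \<alpha>) (e, i) = (tail G e, i)"
  "head (cyclic_cover G l \<alpha>) (e, i) = (head G e, i \<otimes>\<^bsub>integer_mod_group l\<^esub> \<alpha> e)"
  by (simp_all add: cyclic_cover_def)

lemma finite_arcs_cyclic_cover:
  "finite (arcs G) \<Longrightarrow> l > 0 \<Longrightarrow> finite (arcs (cyclic_cover G l \<alpha>))"
  by (simp add: carrier_integer_mod_group)

lemma degree_le_max_degree:
  assumes "fin_digraph G"
  shows "degree G v \<le> max_degree G"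
proof (cases "v \<in> verts G")
  case True
  then show ?thesis
    using fin_digraph.finite_verts[OF assms] by (simp add: max_degree_def)
next
  case False
  interpret fin_digraph G by fact
  have "in_arcs G v = {}" "out_arcs G v = {}" using False by auto
  then show ?thesis by (simp add: degree_def in_degree_def out_degree_def)
qed

text \<open>
  The arcs at a vertex of the cover project injectively to the arcs at the vertex below it, once
  incoming and outgoing arcs are kept apart.
\<close>

lemma degree_cyclic_cover_le:
  assumes fin: "finite (arcs G)" and \<alpha>: "voltage_assignment G l \<alpha>"
  shows "degree (cyclic_cover G l \<alpha>) (v, j) \<le> degree G v"
proof -
  let ?H = "cyclic_cover G l \<alpha>"
  interpret Z: group "integer_mod_group l" by simp
  have fin': "finite (in_arcs G v)" "finite (out_arcs G v)"
    using fin by (simp_all add: in_arcs_def out_arcs_def)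
  have fst_in: "inj_on fst (in_arcs ?H (v, j))"
    using \<alpha> by (auto simp: inj_on_def voltage_assignment_def Pi_iff
        simp del: mult_integer_mod_group)
  have "in_degree ?H (v, j) \<le> in_degree G v"
    unfolding in_degree_def using fin' by (intro card_inj_on_le[OF fst_in]) auto
  moreover have fst_out: "inj_on fst (out_arcs ?H (v, j))"
    by (auto simp: inj_on_def)
  have "out_degree ?H (v, j) \<le> out_degree G v"
    unfolding out_degree_def using fin' by (intro card_inj_on_le[OF fst_out]) auto
  ultimately show ?thesis by (simp add: degree_def)
qed

text \<open>A cover with zero voltages consists of disjoint copies of the base graph, one per residue.\<close>

lemma chromatic_index_cover_empty_supp:
  assumes fin: "finite (arcs G)" and "l > 0" and supp: "voltage_supp G l \<alpha> = {}"
  shows "chromatic_index (cyclic_cover G l \<alpha>) = chromatic_index G"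
proof (rule antisym)
  let ?H = "cyclic_cover G l \<alpha>"
  interpret Z: group "integer_mod_group l" by simp
  have ends: "edge_ends ?H (e, i) = edge_ends G e \<times> {i}"
    if "e \<in> arcs G" "i \<in> carrier (integer_mod_group l)" for e i
  proof -
    have "\<alpha> e = \<one>\<^bsub>integer_mod_group l\<^esub>" using supp that by (auto simp: voltage_supp_def)
    then show ?thesis using Z.r_one[OF that(2)] by (auto simp: edge_ends_def)
  qed
  obtain c where "proper_edge_colouring G (chromatic_index G) c"
    using ex_colouring_chromatic_index[OF fin] .
  then have "proper_edge_colouring ?H (chromatic_index G) (c \<circ> fst)"
    unfolding proper_edge_colouring_def by (fastforce simp: ends Pi_iff)
  then show "chromatic_index ?H \<le> chromatic_index G" by (rule chromatic_index_le)
  obtain d where d: "proper_edge_colouring ?H (chromatic_index ?H) d"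
    using ex_colouring_chromatic_index[OF finite_arcs_cyclic_cover[OF fin \<open>l > 0\<close>]] .
  let ?copy = "\<lambda>e. (e, \<one>\<^bsub>integer_mod_group l\<^esub>)"
  have "proper_edge_colouring G (chromatic_index ?H) (d \<circ> ?copy)"
    unfolding proper_edge_colouring_def
  proof (intro conjI ballI impI)
    show "d \<circ> ?copy \<in> arcs G \<rightarrow> {..<chromatic_index ?H}"
      using d Z.one_closed by (auto simp: proper_edge_colouring_def Pi_iff)
    fix e f
    assume ef: "e \<in> arcs G" "f \<in> arcs G" "e \<noteq> f \<and> edge_ends G e \<inter> edge_ends G f \<noteq> {}"
    then have "?copy e \<in> arcs ?H" "?copy f \<in> arcs ?H" "?copy e \<noteq> ?copy f"
        "edge_ends ?H (?copy e) \<inter> edge_ends ?H (?copy f) \<noteq> {}"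
      using Z.one_closed by (auto simp: ends)
    then show "(d \<circ> ?copy) e \<noteq> (d \<circ> ?copy) f"
      using d unfolding proper_edge_colouring_def comp_def by blast
  qed
  then show "chromatic_index G \<le> chromatic_index ?H" by (rule chromatic_index_le)
qed

text \<open>
  The fibre of an arc that is not a loop is a matching in the cover, so a single fresh colour serves
  the whole fibre, whatever the voltage.
\<close>

lemma chromatic_index_cover_upd_le:
  assumes fin: "finite (arcs G)" and loopless: "loopfree_digraph G" and "l > 0"
    and x: "x \<in> carrier (integer_mod_group l)"
  shows "chromatic_index (cyclic_cover G l (\<alpha>(e := x))) \<le> Suc (chromatic_index (cyclic_cover G l \<alpha>))"
proof -
  let ?H = "cyclic_cover G l \<alpha>" and ?H' = "cyclic_cover G l (\<alpha>(e := x))"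
  let ?n = "chromatic_index ?H"
  interpret Z: group "integer_mod_group l" by simp
  obtain c where c: "proper_edge_colouring ?H ?n c"
    using ex_colouring_chromatic_index[OF finite_arcs_cyclic_cover[OF fin \<open>l > 0\<close>]] .
  define d where "d = (\<lambda>(f, i). if f = e then ?n else c (f, i))"
  have d_fibre: "d (f, i) = ?n \<longleftrightarrow> f = e" and d_other: "f \<noteq> e \<Longrightarrow> d (f, i) = c (f, i)"
    if "(f, i) \<in> arcs ?H" for f i
  proof -
    have "c (f, i) < ?n" using c that by (auto simp: proper_edge_colouring_def Pi_iff)
    then show "d (f, i) = ?n \<longleftrightarrow> f = e" by (auto simp: d_def)
  qed (simp add: d_def)
  have ends: "edge_ends ?H' (f, i) = edge_ends ?H (f, i)" if "f \<noteq> e" for f i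
    using that by (simp add: edge_ends_def)
  have matching: "edge_ends ?H' (e, i) \<inter> edge_ends ?H' (e, j) = {}"
    if "e \<in> arcs G" "i \<in> carrier (integer_mod_group l)" "j \<in> carrier (integer_mod_group l)" "i \<noteq> j"
    for i j
    using that x loopfree_digraph.no_loops[OF loopless that(1)]
    by (auto simp: edge_ends_def simp del: mult_integer_mod_group)
  have "proper_edge_colouring ?H' (Suc ?n) d"
    unfolding proper_edge_colouring_def
  proof (intro conjI ballI impI)
    show "d \<in> arcs ?H' \<rightarrow> {..<Suc ?n}"
      using c by (auto simp: proper_edge_colouring_def Pi_iff d_def less_Suc_eq)
    fix u v
    assume uv: "u \<in> arcs ?H'" "v \<in> arcs ?H'"
      and adj: "u \<noteq> v \<and> edge_ends ?H' u \<inter> edge_ends ?H' v \<noteq> {}"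
    obtain f i g j where [simp]: "u = (f, i)" "v = (g, j)" by (metis surj_pair)
    have arcs: "(f, i) \<in> arcs ?H" "(g, j) \<in> arcs ?H" using uv by auto
    consider "f = e" "g = e" | "f = e \<longleftrightarrow> g \<noteq> e" | "f \<noteq> e" "g \<noteq> e" by blast
    then show "d u \<noteq> d v"
    proof cases
      case 1
      then show ?thesis using uv adj matching[of i j] by auto
    next
      case 2
      then show ?thesis using d_fibre[OF arcs(1)] d_fibre[OF arcs(2)] by auto
    next
      case 3
      then have "c (f, i) \<noteq> c (g, j)"
        using c arcs adj ends[of f i] ends[of g j]
        unfolding proper_edge_colouring_def by auto
      then show ?thesis using 3 d_other arcs by simp
    qed
  qed
  then show ?thesis by (rule chromatic_index_le)
qed

text \<open>
  Adding \<open>l div 2\<close> exchanges the lower and the upper half of the residues, so these halves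
  are the two sides of a bipartition of the cover.
\<close>

lemma chromatic_index_cover_half_le:
  assumes "fin_digraph G" and "l > 0" and "even l"
  shows "voltage_assignment G l (\<lambda>_. int (l div 2))"
    and "chromatic_index (cyclic_cover G l (\<lambda>_. int (l div 2))) \<le> max_degree G"
proof -
  interpret fin_digraph G by fact
  let ?H = "cyclic_cover G l (\<lambda>_. int (l div 2))"
  show \<alpha>: "voltage_assignment G l (\<lambda>_. int (l div 2))"
    using \<open>l > 0\<close> by (simp add: voltage_assignment_def carrier_integer_mod_group)
  define m where "m = int (l div 2)"
  have l: "int l = 2 * m" using \<open>even l\<close> unfolding m_def by presburger
  have shift: "i < m \<longleftrightarrow> \<not> (i + m) mod (2 * m) < m" if "0 \<le> i" "i < 2 * m" for i
  proof (cases "i < m")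
    case True
    then show ?thesis using that by simp
  next
    case False
    then have "(i + m) mod (2 * m) = i - m"
      using that by (intro int_mod_pos_eq[where q = 1]) auto
    then show ?thesis using that False by simp
  qed
  show "chromatic_index ?H \<le> max_degree G"
  proof (rule chromatic_index_bipartite_le[where X = "{(v, i). i < m}"])
    show "finite (arcs ?H)" using finite_arcs_cyclic_cover[OF finite_arcs \<open>l > 0\<close>] .
    show "degree ?H w \<le> max_degree G" for w
      using degree_cyclic_cover_le[OF finite_arcs \<alpha>] degree_le_max_degree[OF assms(1)]
      by (cases w) (blast intro: order_trans)
    show "tail ?H e \<in> {(v, i). i < m} \<longleftrightarrow> head ?H e \<notin> {(v, i). i < m}" if "e \<in> arcs ?H" for e
    proof -
      obtain f i where [simp]: "e = (f, i)" by (cases e)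
      have "0 \<le> i" "i < 2 * m"
        using that \<open>l > 0\<close> by (auto simp: carrier_integer_mod_group l)
      from shift[OF this] show ?thesis
        by (simp add: mult_integer_mod_group l flip: m_def)
    qed
  qed
qed

section \<open>Chromatic indices of covers\<close>

text \<open>
  Smallest support is required among the covers of chromatic index at most \<open>s\<close>, rather than
  exactly \<open>s\<close>: this bounds all smaller supports strictly from below, and that \<open>s\<close> is
  attained then follows by resetting a single arc.
\<close>

lemma ex_cover_chromatic_index_minimal_supp:
  assumes "fin_digraph G" and "loopfree_digraph G" and "l > 0" and "even l"
    and s: "max_degree G \<le> s" "s < chromatic_index G"
  obtains \<alpha> where "voltage_assignment G l \<alpha>" and "chromatic_index (cyclic_cover G l \<alpha>) = s"
    and "\<And>\<alpha>'. voltage_assignment G l \<alpha>' \<Longrightarrow> voltage_supp G l \<alpha>' \<subset> voltage_supp G l \<alpha> \<Longrightarrow>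
      s < chromatic_index (cyclic_cover G l \<alpha>')"
proof -
  interpret fin_digraph G by fact
  let ?\<chi> = "\<lambda>\<alpha>. chromatic_index (cyclic_cover G l \<alpha>)"
  let ?P = "\<lambda>\<alpha>. voltage_assignment G l \<alpha> \<and> ?\<chi> \<alpha> \<le> s"
  have fin_supp: "finite (voltage_supp G l \<alpha>)" for \<alpha> by (simp add: voltage_supp_def)
  have "?P (\<lambda>_. int (l div 2))"
    using chromatic_index_cover_half_le[OF assms(1,3,4)] s by auto
  then obtain \<alpha> where P: "?P \<alpha>"
      and least: "\<And>\<beta>. ?P \<beta> \<Longrightarrow> card (voltage_supp G l \<alpha>) \<le> card (voltage_supp G l \<beta>)"
    using exists_least_iff[of "\<lambda>n. \<exists>\<alpha>. ?P \<alpha> \<and> card (voltage_supp G l \<alpha>) = n"]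
    by (metis not_le)
  have smaller: "s < ?\<chi> \<beta>"
    if "voltage_assignment G l \<beta>" "voltage_supp G l \<beta> \<subset> voltage_supp G l \<alpha>" for \<beta>
    using least[of \<beta>] psubset_card_mono[OF fin_supp that(2)] that(1) by (meson not_le)
  have "voltage_supp G l \<alpha> \<noteq> {}"
    using chromatic_index_cover_empty_supp[OF finite_arcs \<open>l > 0\<close>, of \<alpha>] P s by auto
  then obtain e where e: "e \<in> voltage_supp G l \<alpha>" by blast
  let ?\<beta> = "\<alpha>(e := \<one>\<^bsub>integer_mod_group l\<^esub>)"
  have "voltage_assignment G l ?\<beta>"
    using P \<open>l > 0\<close> by (auto simp: voltage_assignment_def carrier_integer_mod_group)
  moreover have "voltage_supp G l ?\<beta> \<subset> voltage_supp G l \<alpha>"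
    using e by (auto simp: voltage_supp_def)
  ultimately have "s < ?\<chi> ?\<beta>" by (rule smaller)
  also have "\<dots> \<le> Suc (?\<chi> \<alpha>)"
    using chromatic_index_cover_upd_le[OF finite_arcs assms(2,3)] \<open>l > 0\<close>
    by (simp add: carrier_integer_mod_group)
  finally have "?\<chi> \<alpha> = s" using P by linarith
  then show thesis using that P smaller by blast
qed

theorem theorem1p1:
  fixes G :: "('a, 'b) pre_digraph" and l :: nat
  assumes "fin_digraph G" and "loopfree_digraph G"
    and "l \<ge> 2" and "even l"
  shows "\<forall>s \<in> {max_degree G..chromatic_index G}.
    (\<exists>\<alpha>. voltage_assignment G l \<alpha> \<and> chromatic_index (cyclic_cover G l \<alpha>) = s) \<and>
    (s \<noteq> chromatic_index G \<longrightarrow>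
      (\<exists>\<alpha>. voltage_assignment G l \<alpha> \<and> chromatic_index (cyclic_cover G l \<alpha>) = s \<and>
        (\<forall>\<alpha>'. voltage_assignment G l \<alpha>' \<and> voltage_supp G l \<alpha>' \<subset> voltage_supp G l \<alpha> \<longrightarrow>
          chromatic_index (cyclic_cover G l \<alpha>') > chromatic_index (cyclic_cover G l \<alpha>))))"
proof
  have "l > 0" using \<open>l \<ge> 2\<close> by simp
  fix s
  assume s: "s \<in> {max_degree G..chromatic_index G}"
  let ?minimal = "\<exists>\<alpha>. voltage_assignment G l \<alpha> \<and> chromatic_index (cyclic_cover G l \<alpha>) = s \<and>
    (\<forall>\<alpha>'. voltage_assignment G l \<alpha>' \<and> voltage_supp G l \<alpha>' \<subset> voltage_supp G l \<alpha> \<longrightarrow>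
      chromatic_index (cyclic_cover G l \<alpha>') > chromatic_index (cyclic_cover G l \<alpha>))"
  have minimal: ?minimal if "s \<noteq> chromatic_index G"
  proof -
    have "s < chromatic_index G" and "max_degree G \<le> s" using s that by auto
    from ex_cover_chromatic_index_minimal_supp[OF assms(1,2) \<open>l > 0\<close> assms(4) this(2,1)]
    show ?thesis by metis
  qed
  have "\<exists>\<alpha>. voltage_assignment G l \<alpha> \<and> chromatic_index (cyclic_cover G l \<alpha>) = s"
  proof (cases "s = chromatic_index G")
    case True
    have "voltage_assignment G l (\<lambda>_. 0)" and "voltage_supp G l (\<lambda>_. 0) = {}"
      using \<open>l > 0\<close>
      by (auto simp: voltage_assignment_def voltage_supp_def carrier_integer_mod_group)
    then show ?thesis
      using chromatic_index_cover_empty_supp[OF fin_digraph.finite_arcs[OF assms(1)] \<open>l > 0\<close>] True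
      by blast
  next
    case False
    then show ?thesis using minimal by blast
  qed
  then show "(\<exists>\<alpha>. voltage_assignment G l \<alpha> \<and> chromatic_index (cyclic_cover G l \<alpha>) = s) \<and>
    (s \<noteq> chromatic_index G \<longrightarrow> ?minimal)"
    using minimal by blast
qed

end
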